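(* Let $f\in C_{2\pi}^{(\mathcal{F})}(\mathbb{R}^2)$. For $0\le r<1$ and $0\le s<1$ let $P_{rs}$ be the double fuzzy Abel-Poisson convolution operator $$P_{rs}(f;u,v)=\frac{1}{4\pi^2}\int_{-\pi}^{\pi}\int_{-\pi}^{\pi}f(u-x,v-y)\,\psi_r(x)\,\psi_s(y)\,dx\,dy,\qquad (u,v)\in\mathbb{R}^2,$$ where $\psi_r(u)=\dfrac{1-r^2}{1-2r\cos u+r^2}$. Then $\lim_{r,s\to1^-}P_{rs}(f)=f$ uniformly on $\mathbb{R}^2$, i.e. $$\lim_{r,s\to1^-}D^*\left(P_{rs}(f),f\right)=0.$$
   Context: A fuzzy number is a function $\mu:\mathbb{R}\to[0,1]$ that is normal ($\mu(t_0)=1$ for some $t_0$), fuzzy convex ($\mu(\lambda s+(1-\lambda)t)\ge\min\{\mu(s),\mu(t)\}$ for $\lambda\in[0,1]$), upper semicontinuous, and has compact support $\overline{\{t:\mu(t)>0\}}$. $\mathbb{R}_{\mathcal{F}}$ is the set of fuzzy numbers. The $\alpha$-level set is $[\mu]_\alpha=\{t:\mu(t)\ge\alpha\}$ for $0<\alpha\le1$ and $[\mu]_0=\overline{\{t:\mu(t)>0\}}$; it is a compact interval written $[\mu]_\alpha=[\mu_\alpha^-,\mu_\alpha^+]$. Scalar multiplication is levelwise: $[k\mu]_\alpha=k[\mu]_\alpha$. The metric on $\mathbb{R}_{\mathcal{F}}$ is $D(\mu,\eta)=\sup_{\alpha\in[0,1]}\max\{|\mu_\alpha^--\eta_\alpha^-|,|\mu_\alpha^+-\eta_\alpha^+|\}$.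 A function on $\mathbb{R}^2$ is $2\pi$-periodic if $f(u,v)=f(u+2n\pi,v)=f(u,v+2n\pi)$ for all $n\in\mathbb{Z}$ and all $(u,v)$. $C_{2\pi}^{(\mathcal{F})}(\mathbb{R}^2)$ is the set of $2\pi$-periodic functions $f:\mathbb{R}^2\to\mathbb{R}_{\mathcal{F}}$ that are continuous with respect to $D$, with the metric $D^*(f,g)=\sup_{(u,v)\in\mathbb{R}^2}D(f(u,v),g(u,v))$. Integrals of fuzzy valued functions are fuzzy Riemann integrals: for a continuous $g:[a,b]\times[c,d]\to\mathbb{R}_{\mathcal{F}}$ with $[g(x,y)]_\alpha=[g_\alpha^-(x,y),g_\alpha^+(x,y)]$, the integral $\int_c^d\int_a^b g\,dx\,dy$ is the fuzzy number whose $\alpha$-level sets are $\left[\int_c^d\int_a^b g_\alpha^-\,dx\,dy,\ \int_c^d\int_a^b g_\alpha^+\,dx\,dy\right]$, $\alpha\in[0,1]$ (it is a known fact that this is a fuzzy number). The limit $r,s\to1^-$ is the joint limit as $(r,s)\to(1,1)$ with $r,s\in[0,1)$. *)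

theory Defs
  imports "HOL-Analysis.Analysis"
begin

definition upper_semicontinuous :: "('a::topological_space \<Rightarrow> real) \<Rightarrow> bool" where
  "upper_semicontinuous \<mu> \<longleftrightarrow> (\<forall>t c. \<mu> t < c \<longrightarrow> (\<forall>\<^sub>F s in nhds t. \<mu> s < c))"

definition fuzzy_convex :: "(real \<Rightarrow> real) \<Rightarrow> bool" where
  "fuzzy_convex \<mu> \<longleftrightarrow>
     (\<forall>s t. \<forall>l\<in>{0..1}. \<mu> (l * s + (1 - l) * t) \<ge> min (\<mu> s) (\<mu> t))"

definition is_fuzzy_number :: "(real \<Rightarrow> real) \<Rightarrow> bool" where
  "is_fuzzy_number \<mu> \<longleftrightarrow>
     (\<forall>t. \<mu> t \<in> {0..1}) \<and>
     (\<exists>t. \<mu> t = 1) \<and>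
     fuzzy_convex \<mu> \<and>
     upper_semicontinuous \<mu> \<and>
     compact (closure {t. \<mu> t > 0})"

lemma is_fuzzy_number_indicator_0: "is_fuzzy_number (indicator {0})"
proof -
  have "upper_semicontinuous (indicator {0::real})"
    unfolding upper_semicontinuous_def
  proof (intro allI impI)
    fix t c :: real
    assume *: "indicator {0::real} t < c"
    show "\<forall>\<^sub>F s in nhds t. indicator {0::real} s < c"
    proof (cases "t = 0")
      case True
      then have "indicator {0::real} s < c" for s
        using * by (auto simp: indicator_def)
      then show ?thesis by simp
    next
      case False
      then have "\<forall>\<^sub>F s in nhds t. s \<in> - {0::real}"
        by (intro eventually_nhds_in_open) auto
      then show ?thesis
        by eventually_elim (use * False in auto)
    qed
  qed
  moreover have "{t::real. indicator {0} t > (0::real)} = {0}"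
    by (auto simp: indicator_def)
  ultimately show ?thesis
    by (auto simp: is_fuzzy_number_def fuzzy_convex_def indicator_def)
qed

typedef fuzzy_number = "{\<mu>. is_fuzzy_number \<mu>}" morphisms membership Abs_fuzzy_number
  using is_fuzzy_number_indicator_0 by blast

definition level :: "fuzzy_number \<Rightarrow> real \<Rightarrow> real set" where
  "level \<mu> \<alpha> = (if \<alpha> = 0 then closure {t. membership \<mu> t > 0} else {t. membership \<mu> t \<ge> \<alpha>})"

definition lower :: "fuzzy_number \<Rightarrow> real \<Rightarrow> real" where
  "lower \<mu> \<alpha> = Inf (level \<mu> \<alpha>)"

definition upper :: "fuzzy_number \<Rightarrow> real \<Rightarrow> real" where
  "upper \<mu> \<alpha> = Sup (level \<mu> \<alpha>)"

lemma is_fuzzy_number_membership: "is_fuzzy_number (membership \<mu>)"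
  using membership by simp

lemma level_subset_level_0:
  assumes "\<alpha> \<in> {0..1}"
  shows "level \<mu> \<alpha> \<subseteq> level \<mu> 0"
proof (cases "\<alpha> = 0")
  case False
  with assms have "level \<mu> \<alpha> \<subseteq> {t. membership \<mu> t > 0}"
    by (auto simp: level_def)
  then show ?thesis
    using closure_subset[of "{t. membership \<mu> t > 0}"] by (simp add: level_def)
qed simp

lemma level_nonempty:
  assumes "\<alpha> \<in> {0..1}"
  shows "level \<mu> \<alpha> \<noteq> {}"
proof -
  obtain t where "membership \<mu> t = 1"
    using is_fuzzy_number_membership unfolding is_fuzzy_number_def by blast
  with assms have "t \<in> level \<mu> \<alpha>"
    using closure_subset[of "{t. membership \<mu> t > 0}"] by (auto simp: level_def)
  then show ?thesis by blast
qed

lemma compact_level_0: "compact (level \<mu> 0)"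
  using is_fuzzy_number_membership by (simp add: level_def is_fuzzy_number_def)

lemma compact_level:
  assumes "\<alpha> \<in> {0..1}"
  shows "compact (level \<mu> \<alpha>)"
proof (cases "\<alpha> = 0")
  case False
  have usc: "upper_semicontinuous (membership \<mu>)"
    using is_fuzzy_number_membership unfolding is_fuzzy_number_def by blast
  have "open {t. membership \<mu> t < \<alpha>}"
    unfolding open_subopen[of "{t. membership \<mu> t < \<alpha>}"]
    using usc by (fastforce simp: upper_semicontinuous_def eventually_nhds)
  moreover have "level \<mu> \<alpha> = - {t. membership \<mu> t < \<alpha>}"
    using False by (auto simp: level_def)
  ultimately have "closed (level \<mu> \<alpha>)"
    by (simp add: closed_def)
  then have "compact (level \<mu> 0 \<inter> level \<mu> \<alpha>)"
    using compact_level_0 by (intro compact_Int_closed)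
  then show ?thesis
    using level_subset_level_0[OF assms, of \<mu>] by (simp add: Int_absorb1)
qed (simp add: compact_level_0)

lemma convex_level: "convex (level \<mu> \<alpha>)"
proof -
  have cv: "fuzzy_convex (membership \<mu>)"
    using is_fuzzy_number_membership unfolding is_fuzzy_number_def by blast
  have min: "membership \<mu> (u * x + v * y) \<ge> min (membership \<mu> x) (membership \<mu> y)"
    if "u \<ge> 0" "v \<ge> 0" "u + v = 1" for u v x y
  proof -
    have "v = 1 - u" "u \<in> {0..1}" using that by auto
    then show ?thesis using cv unfolding fuzzy_convex_def by blast
  qed
  have "convex {t. membership \<mu> t > 0}"
    unfolding convex_def by (auto intro: less_le_trans[OF _ min])
  moreover have "convex {t. membership \<mu> t \<ge> \<alpha>}"
    unfolding convex_def by (auto intro: order_trans[OF _ min])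
  ultimately show ?thesis
    by (simp add: level_def convex_closure)
qed

lemma level_eq_atLeastAtMost:
  assumes "\<alpha> \<in> {0..1}"
  shows "level \<mu> \<alpha> = {lower \<mu> \<alpha>..upper \<mu> \<alpha>}"
proof -
  obtain a b where ab: "level \<mu> \<alpha> = {a..b}"
    using compact_level[OF assms] convex_level connected_compact_interval_1 convex_connected
    by metis
  moreover have "a \<le> b"
    using ab level_nonempty[OF assms, of \<mu>] by simp
  ultimately show ?thesis
    by (simp add: lower_def upper_def)
qed

lemma fuzzy_number_eqI:
  assumes "\<And>\<alpha>. \<alpha> \<in> {0..1} \<Longrightarrow> level \<mu> \<alpha> = level \<eta> \<alpha>"
  shows "\<mu> = \<eta>"
proof -
  have le: "membership \<mu> t \<le> membership \<eta> t"
    if "\<And>\<alpha>. \<alpha> \<in> {0..1} \<Longrightarrow> level \<mu> \<alpha> = level \<eta> \<alpha>" for \<mu> \<eta> t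
  proof -
    have r: "membership \<mu> t \<in> {0..1}" "membership \<eta> t \<in> {0..1}"
      using is_fuzzy_number_membership unfolding is_fuzzy_number_def by blast+
    show ?thesis
    proof (cases "membership \<mu> t = 0")
      case False
      then have "t \<in> level \<mu> (membership \<mu> t)" by (simp add: level_def)
      then have "t \<in> level \<eta> (membership \<mu> t)" using that r by blast
      then show ?thesis using False by (simp add: level_def)
    qed (use r in auto)
  qed
  have "membership \<mu> = membership \<eta>"
    by (intro ext antisym le) (use assms in auto)
  then show ?thesis by (simp add: membership_inject)
qed

lemma lower_upper_bounded:
  assumes "\<alpha> \<in> {0..1}"
  shows "lower \<mu> 0 \<le> lower \<mu> \<alpha>" "lower \<mu> \<alpha> \<le> upper \<mu> \<alpha>" "upper \<mu> \<alpha> \<le> upper \<mu> 0"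
  using level_subset_level_0[OF assms, of \<mu>] level_nonempty[OF assms, of \<mu>]
    level_eq_atLeastAtMost[OF assms, of \<mu>] level_eq_atLeastAtMost[of 0 \<mu>]
  by auto

instantiation fuzzy_number :: metric_space
begin

definition dist_fuzzy_number :: "fuzzy_number \<Rightarrow> fuzzy_number \<Rightarrow> real" where
  "dist \<mu> \<eta> = (SUP \<alpha>\<in>{0..1}. max \<bar>lower \<mu> \<alpha> - lower \<eta> \<alpha>\<bar> \<bar>upper \<mu> \<alpha> - upper \<eta> \<alpha>\<bar>)"

definition uniformity_fuzzy_number :: "(fuzzy_number \<times> fuzzy_number) filter" where
  "uniformity_fuzzy_number = (INF e\<in>{0<..}. principal {(\<mu>, \<eta>). dist \<mu> \<eta> < e})"

definition open_fuzzy_number :: "fuzzy_number set \<Rightarrow> bool" where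
  "open_fuzzy_number U \<longleftrightarrow> (\<forall>\<mu>\<in>U. \<forall>\<^sub>F (\<mu>', \<eta>) in uniformity. \<mu>' = \<mu> \<longrightarrow> \<eta> \<in> U)"

lemma bdd_above_dist_fuzzy_number:
  "bdd_above ((\<lambda>\<alpha>. max \<bar>lower \<mu> \<alpha> - lower \<eta> \<alpha>\<bar> \<bar>upper \<mu> \<alpha> - upper \<eta> \<alpha>\<bar>) ` {0..1})"
proof (rule bdd_aboveI2)
  fix \<alpha> :: real
  assume "\<alpha> \<in> {0..1}"
  from lower_upper_bounded[OF this, of \<mu>] lower_upper_bounded[OF this, of \<eta>]
  show "max \<bar>lower \<mu> \<alpha> - lower \<eta> \<alpha>\<bar> \<bar>upper \<mu> \<alpha> - upper \<eta> \<alpha>\<bar>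
    \<le> \<bar>lower \<mu> 0\<bar> + \<bar>upper \<mu> 0\<bar> + \<bar>lower \<eta> 0\<bar> + \<bar>upper \<eta> 0\<bar>"
    by linarith
qed

lemma level_dist_le:
  assumes "\<alpha> \<in> {0..1}"
  shows "max \<bar>lower \<mu> \<alpha> - lower \<eta> \<alpha>\<bar> \<bar>upper \<mu> \<alpha> - upper \<eta> \<alpha>\<bar> \<le> dist \<mu> \<eta>"
  unfolding dist_fuzzy_number_def using assms bdd_above_dist_fuzzy_number by (rule cSUP_upper)

instance
proof
  fix \<mu> \<eta> \<xi> :: fuzzy_number
  show "dist \<mu> \<eta> = 0 \<longleftrightarrow> \<mu> = \<eta>"
  proof
    assume *: "dist \<mu> \<eta> = 0"
    show "\<mu> = \<eta>"
    proof (rule fuzzy_number_eqI)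
      fix \<alpha> :: real
      assume \<alpha>: "\<alpha> \<in> {0..1}"
      from level_dist_le[OF this, of \<mu> \<eta>] *
      have "lower \<mu> \<alpha> = lower \<eta> \<alpha>" "upper \<mu> \<alpha> = upper \<eta> \<alpha>" by auto
      with \<alpha> show "level \<mu> \<alpha> = level \<eta> \<alpha>" by (simp add: level_eq_atLeastAtMost)
    qed
  qed (simp add: dist_fuzzy_number_def)
  show "dist \<mu> \<eta> \<le> dist \<mu> \<xi> + dist \<eta> \<xi>"
    unfolding dist_fuzzy_number_def[of \<mu> \<eta>]
  proof (rule cSUP_least)
    fix \<alpha> :: real
    assume "\<alpha> \<in> {0..1}"
    from level_dist_le[OF this, of \<mu> \<xi>] level_dist_le[OF this, of \<eta> \<xi>]
    show "max \<bar>lower \<mu> \<alpha> - lower \<eta> \<alpha>\<bar> \<bar>upper \<mu> \<alpha> - upper \<eta> \<alpha>\<bar> \<le> dist \<mu> \<xi> + dist \<eta> \<xi>"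
      by linarith
  qed simp
qed (simp_all add: uniformity_fuzzy_number_def open_fuzzy_number_def)

end

(* A fuzzy number is determined by its level sets (fuzzy_number_eqI), so the descriptions below
   are unique. The families of level sets are those of a fuzzy number for every k, respectively
   whenever g is continuous; the iterated Henstock-Kurzweil integrals are then Riemann integrals,
   because the end point functions of a continuous g are continuous for each fixed level. *)

definition fuzzy_scale :: "real \<Rightarrow> fuzzy_number \<Rightarrow> fuzzy_number"  (infixr "*\<^sub>F" 75) where
  "k *\<^sub>F \<mu> = (THE \<eta>. \<forall>\<alpha>\<in>{0..1}. level \<eta> \<alpha> = (\<lambda>t. k * t) ` level \<mu> \<alpha>)"

definition fuzzy_integral ::
  "real \<Rightarrow> real \<Rightarrow> real \<Rightarrow> real \<Rightarrow> (real \<Rightarrow> real \<Rightarrow> fuzzy_number) \<Rightarrow> fuzzy_number" where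
  "fuzzy_integral a b c d g = (THE \<eta>. \<forall>\<alpha>\<in>{0..1}. level \<eta> \<alpha> =
     {integral {c..d} (\<lambda>y. integral {a..b} (\<lambda>x. lower (g x y) \<alpha>)) ..
      integral {c..d} (\<lambda>y. integral {a..b} (\<lambda>x. upper (g x y) \<alpha>))})"

definition periodic_2pi :: "(real \<times> real \<Rightarrow> 'a) \<Rightarrow> bool" where
  "periodic_2pi f \<longleftrightarrow> (\<forall>u v. \<forall>n::int.
     f (u, v) = f (u + 2 * of_int n * pi, v) \<and> f (u, v) = f (u, v + 2 * of_int n * pi))"

definition C_2pi :: "(real \<times> real \<Rightarrow> fuzzy_number) set" where
  "C_2pi = {f. periodic_2pi f \<and> continuous_on UNIV f}"

definition dist_star ::
  "(real \<times> real \<Rightarrow> fuzzy_number) \<Rightarrow> (real \<times> real \<Rightarrow> fuzzy_number) \<Rightarrow> real" where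
  "dist_star f g = (SUP p. dist (f p) (g p))"

definition poisson_kernel :: "real \<Rightarrow> real \<Rightarrow> real" where
  "poisson_kernel r u = (1 - r\<^sup>2) / (1 - 2 * r * cos u + r\<^sup>2)"

definition abel_poisson ::
  "real \<Rightarrow> real \<Rightarrow> (real \<times> real \<Rightarrow> fuzzy_number) \<Rightarrow> real \<times> real \<Rightarrow> fuzzy_number" where
  "abel_poisson r s f = (\<lambda>(u, v). (1 / (4 * pi\<^sup>2)) *\<^sub>F
     fuzzy_integral (-pi) pi (-pi) pi
       (\<lambda>x y. (poisson_kernel r x * poisson_kernel s y) *\<^sub>F f (u - x, v - y)))"

end

theory Submission
  imports Defs
begin

text \<open>
  A Korovkin-type argument. The end points of the level sets of a fuzzy convolution are the real
  convolutions of the end points. Uniform continuity and periodicity give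
  \<open>D(f(u - x, v - y), f(u, v)) \<le> \<epsilon> + C ((1 - cos x) + (1 - cos y))\<close> on \<open>[-\<pi>, \<pi>]\<^sup>2\<close>, and averaging this
  against the normalised kernel yields \<open>\<epsilon> + C ((1 - r) + (1 - s))\<close>, because the mean of
  \<open>1 - cos\<close> under \<open>\<psi>\<^sub>r\<close> is \<open>1 - r\<close>. That the levelwise scalar multiples and
  integrals really are level sets of fuzzy numbers rests on the characterisation of such families by
  monotonicity, left continuity on \<open>(0, 1]\<close> and right continuity at \<open>0\<close>.
\<close>

subsection \<open>Fuzzy numbers from families of intervals\<close>

text \<open>Turns a left-sided filter statement into one witness below \<open>a\<close> that is
  still an admissible level, hence the truncation at 0.\<close>

lemma ex_less_of_eventually_at_left:
  fixes a :: real
  assumes "eventually P (at a within {0..<a})" "0 < a"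
  obtains b where "0 \<le> b" "b < a" "P b"
proof -
  obtain d where d: "d > 0" "\<And>b. b \<in> {0..<a} \<Longrightarrow> b \<noteq> a \<Longrightarrow> dist b a < d \<Longrightarrow> P b"
    using assms(1) unfolding eventually_at by blast
  have "P (max 0 (a - d / 2))"
    using d(1) assms(2) by (intro d(2)) (auto simp: dist_real_def)
  then show ?thesis
    using d(1) assms(2) by (intro that[of "max 0 (a - d / 2)"]) auto
qed

lemma ex_pos_of_eventually_at_0:
  assumes "eventually P (at (0::real) within {0<..1})"
  obtains b where "0 < b" "b \<le> 1" "P b"
proof -
  obtain d where d: "d > 0" "\<And>b. b \<in> {0<..1} \<Longrightarrow> b \<noteq> 0 \<Longrightarrow> dist b 0 < d \<Longrightarrow> P b"
    using assms(1) unfolding eventually_at by blast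
  have "P (min 1 (d / 2))"
    using d(1) by (intro d(2)) (auto simp: dist_real_def)
  then show ?thesis
    using d(1) by (intro that[of "min 1 (d / 2)"]) auto
qed

lemma le_of_tendsto_at_left:
  fixes h :: "real \<Rightarrow> real"
  assumes "(h \<longlongrightarrow> h a) (at a within {0..<a})" "0 < a" "\<And>b. 0 \<le> b \<Longrightarrow> b < a \<Longrightarrow> h b \<le> t"
  shows "h a \<le> t"
proof (rule ccontr)
  assume "\<not> h a \<le> t"
  then have "eventually (\<lambda>b. t < h b) (at a within {0..<a})"
    using assms(1) by (intro order_tendstoD) auto
  then obtain b where "0 \<le> b" "b < a" "t < h b"
    using ex_less_of_eventually_at_left assms(2) by blast
  with assms(3)[of b] show False by simp
qed

text \<open>The membership degree of a point is the supremum of the levels whose interval contains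
  it. Left continuity makes each interval at a positive level exactly the cut of this function;
  right continuity at 0 makes the interval at level 0 the closure of the support.\<close>

lemma fuzzy_number_of_levels:
  fixes l u :: "real \<Rightarrow> real"
  assumes l_mono: "\<And>a b. 0 \<le> a \<Longrightarrow> a \<le> b \<Longrightarrow> b \<le> 1 \<Longrightarrow> l a \<le> l b"
    and u_anti: "\<And>a b. 0 \<le> a \<Longrightarrow> a \<le> b \<Longrightarrow> b \<le> 1 \<Longrightarrow> u b \<le> u a"
    and le: "l 1 \<le> u 1"
    and l_left: "\<And>a. 0 < a \<Longrightarrow> a \<le> 1 \<Longrightarrow> (l \<longlongrightarrow> l a) (at a within {0..<a})"
    and u_left: "\<And>a. 0 < a \<Longrightarrow> a \<le> 1 \<Longrightarrow> (u \<longlongrightarrow> u a) (at a within {0..<a})"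
    and l_right: "(l \<longlongrightarrow> l 0) (at 0 within {0<..1})"
    and u_right: "(u \<longlongrightarrow> u 0) (at 0 within {0<..1})"
  shows "\<exists>\<eta>. \<forall>\<alpha>\<in>{0..1}. level \<eta> \<alpha> = {l \<alpha>..u \<alpha>}"
proof -
  \<comment> \<open>Inserting 0 keeps the set nonempty, so a point outside all intervals gets degree
    0.\<close>
  define A where "A t = insert 0 {\<alpha>\<in>{0..1}. t \<in> {l \<alpha>..u \<alpha>}}" for t
  define \<mu> where "\<mu> t = Sup (A t)" for t
  have A_sub: "A t \<subseteq> {0..1}" and zero_A: "0 \<in> A t" for t
    by (auto simp: A_def)
  have bdd: "bdd_above (A t)" for t
    using A_sub by (meson bdd_above_Icc bdd_above_mono)
  have \<mu>_range: "\<mu> t \<in> {0..1}" for t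
    unfolding \<mu>_def using A_sub[of t] zero_A[of t] bdd[of t]
    by (auto intro!: cSup_least cSup_upper)
  have \<mu>_ge: "\<alpha> \<le> \<mu> t \<longleftrightarrow> t \<in> {l \<alpha>..u \<alpha>}" if \<alpha>: "0 < \<alpha>" "\<alpha> \<le> 1" for \<alpha> t
  proof
    assume "t \<in> {l \<alpha>..u \<alpha>}"
    then show "\<alpha> \<le> \<mu> t"
      unfolding \<mu>_def using \<alpha> bdd by (intro cSup_upper) (auto simp: A_def)
  next
    assume ge: "\<alpha> \<le> \<mu> t"
    \<comment> \<open>A \<open>\<gamma>\<close> in \<open>A t\<close> with
      \<open>\<gamma> > \<beta> \<ge> 0\<close> is not the inserted 0, so \<open>t\<close> lies in
      its interval, and the intervals shrink as the level grows.\<close>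
    have below: "t \<in> {l \<beta>..u \<beta>}" if "0 \<le> \<beta>" "\<beta> < \<alpha>" for \<beta>
    proof -
      have "\<beta> < Sup (A t)" using ge that by (simp add: \<mu>_def)
      then obtain \<gamma> where "\<gamma> \<in> A t" "\<beta> < \<gamma>"
        using less_cSup_iff[OF _ bdd] zero_A by blast
      then have "\<gamma> \<le> 1" "\<beta> \<le> \<gamma>" "t \<in> {l \<gamma>..u \<gamma>}"
        using that by (auto simp: A_def)
      then show ?thesis
        using l_mono[of \<beta> \<gamma>] u_anti[of \<beta> \<gamma>] that by auto
    qed
    have "l \<alpha> \<le> t"
      using le_of_tendsto_at_left[OF l_left[OF \<alpha>] \<alpha>(1)] below by auto
    \<comment> \<open>The upper end points are handled by applying the same one-sided bound to their
      negatives.\<close>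
    moreover have "- u \<alpha> \<le> - t"
      by (rule le_of_tendsto_at_left[OF tendsto_minus[OF u_left[OF \<alpha>]] \<alpha>(1)]) (use below in auto)
    ultimately show "t \<in> {l \<alpha>..u \<alpha>}" by simp
  qed
  have support: "closure {t. \<mu> t > 0} = {l 0..u 0}"
  proof
    have "{t. \<mu> t > 0} \<subseteq> {l 0..u 0}"
    proof
      fix t assume "t \<in> {t. \<mu> t > 0}"
      then have "0 < \<mu> t" "\<mu> t \<le> 1" using \<mu>_range[of t] by auto
      then have "t \<in> {l (\<mu> t)..u (\<mu> t)}" using \<mu>_ge by blast
      with \<open>0 < \<mu> t\<close> \<open>\<mu> t \<le> 1\<close> show "t \<in> {l 0..u 0}"
        using l_mono[of 0 "\<mu> t"] u_anti[of 0 "\<mu> t"] by auto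
    qed
    then show "closure {t. \<mu> t > 0} \<subseteq> {l 0..u 0}"
      by (simp add: closure_minimal)
  next
    show "{l 0..u 0} \<subseteq> closure {t. \<mu> t > 0}"
    proof
      fix t assume t: "t \<in> {l 0..u 0}"
      have "\<exists>s\<in>{t. \<mu> t > 0}. dist s t < e" if e: "e > 0" for e
      proof -
        have "eventually (\<lambda>\<beta>. l \<beta> < l 0 + e \<and> u 0 - e < u \<beta>) (at 0 within {0<..1})"
          using e by (intro eventually_conj order_tendstoD[OF l_right] order_tendstoD[OF u_right]) auto
        then obtain \<beta> where \<beta>: "0 < \<beta>" "\<beta> \<le> 1" "l \<beta> < l 0 + e" "u 0 - e < u \<beta>"
          using ex_pos_of_eventually_at_0 by blast
        \<comment> \<open>This is the projection of \<open>t\<close> to the interval at level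
          \<open>\<beta>\<close>. Its end points are within \<open>e\<close> of those at level 0, so
          \<open>t\<close> moves by less than \<open>e\<close>.\<close>
        define s where "s = max (l \<beta>) (min t (u \<beta>))"
        have "l \<beta> \<le> u \<beta>"
          using l_mono[of \<beta> 1] u_anti[of \<beta> 1] le \<beta> by linarith
        then have "s \<in> {l \<beta>..u \<beta>}" by (auto simp: s_def)
        then have "\<mu> s > 0" using \<mu>_ge[of \<beta> s] \<beta> by auto
        moreover have "dist s t < e"
          using \<beta> t e \<open>l \<beta> \<le> u \<beta>\<close> by (auto simp: s_def dist_real_def abs_if max_def min_def)
        ultimately show ?thesis by blast
      qed
      then show "t \<in> closure {t. \<mu> t > 0}"
        by (simp add: closure_approachable)
    qed
  qed
  have "is_fuzzy_number \<mu>"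
    unfolding is_fuzzy_number_def
  proof (intro conjI allI)
    show "\<mu> t \<in> {0..1}" for t by (rule \<mu>_range)
    show "\<exists>t. \<mu> t = 1"
      using \<mu>_ge[of 1 "l 1"] \<mu>_range[of "l 1"] le by (intro exI[of _ "l 1"]) auto
    show "fuzzy_convex \<mu>"
      unfolding fuzzy_convex_def
    proof (intro allI ballI)
      fix s t k :: real
      assume k: "k \<in> {0..1}"
      \<comment> \<open>For \<open>m > 0\<close> both points lie in the interval at level
        \<open>m\<close>, which is convex; for \<open>m = 0\<close> the claim is nonnegativity of
        \<open>\<mu>\<close>.\<close>
      define m where "m = min (\<mu> s) (\<mu> t)"
      show "min (\<mu> s) (\<mu> t) \<le> \<mu> (k * s + (1 - k) * t)"
      proof (cases "m = 0")
        case True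
        then show ?thesis using \<mu>_range[of "k * s + (1 - k) * t"] by (simp add: m_def)
      next
        case False
        then have m: "0 < m" "m \<le> 1" "m \<le> \<mu> s" "m \<le> \<mu> t"
          using \<mu>_range[of s] \<mu>_range[of t] by (auto simp: m_def min_def)
        then have "s \<in> {l m..u m}" "t \<in> {l m..u m}" using \<mu>_ge by blast+
        then have "k *\<^sub>R s + (1 - k) *\<^sub>R t \<in> {l m..u m}"
          using k by (intro convexD[OF convex_real_interval(5)]) auto
        then have "m \<le> \<mu> (k * s + (1 - k) * t)" using \<mu>_ge[OF m(1,2)] by simp
        then show ?thesis by (simp add: m_def)
      qed
    qed
    show "upper_semicontinuous \<mu>"
      unfolding upper_semicontinuous_def
    proof (intro allI impI)
      fix t c assume tc: "\<mu> t < c"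
      show "\<forall>\<^sub>F s in nhds t. \<mu> s < c"
      \<comment> \<open>For \<open>c\<close> in (0, 1] the points with \<open>\<mu> < c\<close> form
        the complement of a closed interval; above 1 the bound holds everywhere.\<close>
      proof (cases "c > 1")
        case True
        then have "\<mu> s < c" for s using \<mu>_range[of s] by auto
        then show ?thesis by simp
      next
        case False
        then have c: "0 < c" "c \<le> 1" using \<mu>_range[of t] tc by auto
        have "t \<in> - {l c..u c}" using tc \<mu>_ge[OF c, of t] by auto
        then have "\<forall>\<^sub>F s in nhds t. s \<in> - {l c..u c}"
          by (intro eventually_nhds_in_open) auto
        then show ?thesis
        proof eventually_elim
          case (elim s)
          then show ?case using \<mu>_ge[OF c, of s] by auto
        qed
      qed
    qed
    show "compact (closure {t. 0 < \<mu> t})" by (simp add: support)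
  qed
  then have mem: "membership (Abs_fuzzy_number \<mu>) = \<mu>"
    by (simp add: Abs_fuzzy_number_inverse)
  have "level (Abs_fuzzy_number \<mu>) \<alpha> = {l \<alpha>..u \<alpha>}" if "\<alpha> \<in> {0..1}" for \<alpha>
    using that support \<mu>_ge[of \<alpha>] by (auto simp: level_def mem)
  then show ?thesis by blast
qed

section \<open>Monotonicity and one-sided continuity of the end points of a fuzzy number\<close>

lemma lower_upper_eqI:
  assumes "level \<mu> \<alpha> = {a..b}" "\<alpha> \<in> {0..1}"
  shows "lower \<mu> \<alpha> = a" "upper \<mu> \<alpha> = b"
  using level_nonempty[OF assms(2), of \<mu>] by (simp_all add: lower_def upper_def assms(1))

lemma level_antimono:
  assumes "0 \<le> \<alpha>" "\<alpha> \<le> \<beta>" "\<beta> \<le> 1"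
  shows "level \<mu> \<beta> \<subseteq> level \<mu> \<alpha>"
proof (cases "\<alpha> = 0")
  case True
  then show ?thesis using level_subset_level_0[of \<beta> \<mu>] assms by simp
next
  case False
  then show ?thesis using assms by (auto simp: level_def)
qed

lemma lower_mono_upper_antimono:
  assumes "0 \<le> \<alpha>" "\<alpha> \<le> \<beta>" "\<beta> \<le> 1"
  shows "lower \<mu> \<alpha> \<le> lower \<mu> \<beta>" "upper \<mu> \<beta> \<le> upper \<mu> \<alpha>"
  using level_antimono[OF assms, of \<mu>] level_eq_atLeastAtMost[of \<alpha> \<mu>]
    level_eq_atLeastAtMost[of \<beta> \<mu>] lower_upper_bounded[of \<beta> \<mu>] assms
  by auto

text \<open>A point outside the level set at \<open>\<alpha>\<close> has degree below
  \<open>\<alpha>\<close>, so it is also outside the level sets at \<open>\<beta>\<close> once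
  \<open>\<beta>\<close> is close to \<open>\<alpha>\<close> from the left. This gives one half of
  each limit; monotonicity gives the other.\<close>

lemma lower_upper_tendsto_left:
  assumes "0 < \<alpha>" "\<alpha> \<le> 1"
  shows "(lower \<mu> \<longlongrightarrow> lower \<mu> \<alpha>) (at \<alpha> within {0..<\<alpha>})"
    and "(upper \<mu> \<longlongrightarrow> upper \<mu> \<alpha>) (at \<alpha> within {0..<\<alpha>})"
proof -
  have in_dom: "eventually (\<lambda>\<beta>. \<beta> \<in> {0..<\<alpha>}) (at \<alpha> within {0..<\<alpha>})"
    by (simp add: eventually_at_filter)
  have avoid: "eventually (\<lambda>\<beta>. c \<notin> level \<mu> \<beta>) (at \<alpha> within {0..<\<alpha>})" if "c \<notin> level \<mu> \<alpha>" for c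
  proof -
    have c: "membership \<mu> c < \<alpha>" using that assms by (auto simp: level_def)
    \<comment> \<open>This forces \<open>\<beta> > 0\<close> whenever \<open>\<beta>\<close> exceeds
      the degree of \<open>c\<close>, so that \<open>level\<close> is a cut there and not the
      closure of the support.\<close>
    have "0 \<le> membership \<mu> c"
      using is_fuzzy_number_membership[of \<mu>] by (simp add: is_fuzzy_number_def)
    have "eventually (\<lambda>\<beta>. membership \<mu> c < \<beta>) (at \<alpha> within {0..<\<alpha>})"
      using c by (intro order_tendstoD[OF tendsto_ident_at])
    then show ?thesis
    proof eventually_elim
      case (elim \<beta>)
      then show ?case using \<open>0 \<le> membership \<mu> c\<close> by (auto simp: level_def)
    qed
  qed
  have sub: "lower \<mu> \<beta> \<le> lower \<mu> \<alpha> \<and> upper \<mu> \<alpha> \<le> upper \<mu> \<beta> \<and> lower \<mu> \<alpha> \<le> upper \<mu> \<alpha>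
      \<and> level \<mu> \<beta> = {lower \<mu> \<beta>..upper \<mu> \<beta>}"
    if "\<beta> \<in> {0..<\<alpha>}" for \<beta>
    using lower_mono_upper_antimono[of \<beta> \<alpha> \<mu>] level_eq_atLeastAtMost[of \<beta> \<mu>]
      lower_upper_bounded[of \<alpha> \<mu>] that assms by auto
  have lvl: "level \<mu> \<alpha> = {lower \<mu> \<alpha>..upper \<mu> \<alpha>}"
    using assms by (intro level_eq_atLeastAtMost) auto
  show "(lower \<mu> \<longlongrightarrow> lower \<mu> \<alpha>) (at \<alpha> within {0..<\<alpha>})"
  proof (rule order_tendstoI)
    fix c assume c: "c < lower \<mu> \<alpha>"
    then have "c \<notin> level \<mu> \<alpha>" by (simp add: lvl)
    from avoid[OF this] in_dom show "eventually (\<lambda>\<beta>. c < lower \<mu> \<beta>) (at \<alpha> within {0..<\<alpha>})"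
    proof eventually_elim
      case (elim \<beta>)
      then show ?case using sub[of \<beta>] c by auto
    qed
  next
    fix c assume c: "lower \<mu> \<alpha> < c"
    from in_dom show "eventually (\<lambda>\<beta>. lower \<mu> \<beta> < c) (at \<alpha> within {0..<\<alpha>})"
    proof eventually_elim
      case (elim \<beta>)
      then show ?case using sub[of \<beta>] c by auto
    qed
  qed
  show "(upper \<mu> \<longlongrightarrow> upper \<mu> \<alpha>) (at \<alpha> within {0..<\<alpha>})"
  proof (rule order_tendstoI)
    fix c assume c: "upper \<mu> \<alpha> < c"
    then have "c \<notin> level \<mu> \<alpha>" by (simp add: lvl)
    from avoid[OF this] in_dom show "eventually (\<lambda>\<beta>. upper \<mu> \<beta> < c) (at \<alpha> within {0..<\<alpha>})"
    proof eventually_elim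
      case (elim \<beta>)
      then show ?case using sub[of \<beta>] c by auto
    qed
  next
    fix c assume c: "c < upper \<mu> \<alpha>"
    from in_dom show "eventually (\<lambda>\<beta>. c < upper \<mu> \<beta>) (at \<alpha> within {0..<\<alpha>})"
    proof eventually_elim
      case (elim \<beta>)
      then show ?case using sub[of \<beta>] c by auto
    qed
  qed
qed

text \<open>The level set at 0 is a closure, so its end points are approximated by points
  \<open>s\<close> of positive degree, and such an \<open>s\<close> belongs to every level set at
  \<open>\<beta>\<close> with \<open>0 < \<beta>\<close> below its degree.\<close>

lemma lower_upper_tendsto_0:
  shows "(lower \<mu> \<longlongrightarrow> lower \<mu> 0) (at 0 within {0<..1})"
    and "(upper \<mu> \<longlongrightarrow> upper \<mu> 0) (at 0 within {0<..1})"
proof -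
  have in_dom: "eventually (\<lambda>\<beta>. \<beta> \<in> {0<..1}) (at 0 within {0<..1::real})"
    by (simp add: eventually_at_filter)
  have bounds: "lower \<mu> 0 \<le> lower \<mu> \<beta> \<and> upper \<mu> \<beta> \<le> upper \<mu> 0
      \<and> level \<mu> \<beta> = {lower \<mu> \<beta>..upper \<mu> \<beta>}" if "\<beta> \<in> {0<..1}" for \<beta>
    using lower_upper_bounded[of \<beta> \<mu>] level_eq_atLeastAtMost[of \<beta> \<mu>] that by auto
  have near: "eventually (\<lambda>\<beta>. \<exists>s\<in>level \<mu> \<beta>. dist s t < e) (at 0 within {0<..1})"
    if "t \<in> level \<mu> 0" "e > 0" for t e
  proof -
    obtain s where s: "membership \<mu> s > 0" "dist s t < e"
      using \<open>t \<in> level \<mu> 0\<close> \<open>e > 0\<close> by (auto simp: level_def closure_approachable)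
    have "eventually (\<lambda>\<beta>. \<beta> < membership \<mu> s) (at 0 within {0<..1})"
      using s by (intro order_tendstoD[OF tendsto_ident_at])
    then show ?thesis
      using in_dom
    proof eventually_elim
      case (elim \<beta>)
      then have "s \<in> level \<mu> \<beta>" by (simp add: level_def)
      with s show ?case by blast
    qed
  qed
  have mem0: "lower \<mu> 0 \<in> level \<mu> 0" "upper \<mu> 0 \<in> level \<mu> 0"
    using level_eq_atLeastAtMost[of 0 \<mu>] lower_upper_bounded[of 0 \<mu>] by auto
  show "(lower \<mu> \<longlongrightarrow> lower \<mu> 0) (at 0 within {0<..1})"
  proof (rule tendstoI)
    fix e :: real assume "e > 0"
    from near[OF mem0(1) this] in_dom
    show "eventually (\<lambda>\<beta>. dist (lower \<mu> \<beta>) (lower \<mu> 0) < e) (at 0 within {0<..1})"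
    proof eventually_elim
      case (elim \<beta>)
      then show ?case using bounds[of \<beta>] by (fastforce simp: dist_real_def abs_if split: if_splits)
    qed
  qed
  show "(upper \<mu> \<longlongrightarrow> upper \<mu> 0) (at 0 within {0<..1})"
  proof (rule tendstoI)
    fix e :: real assume "e > 0"
    from near[OF mem0(2) this] in_dom
    show "eventually (\<lambda>\<beta>. dist (upper \<mu> \<beta>) (upper \<mu> 0) < e) (at 0 within {0<..1})"
    proof eventually_elim
      case (elim \<beta>)
      then show ?case using bounds[of \<beta>] by (fastforce simp: dist_real_def abs_if split: if_splits)
    qed
  qed
qed

subsection \<open>End points of scalar multiples and integrals\<close>

text \<open>A nonnegative factor preserves the order of the end points as well as their monotonicity
  and one-sided limits, so the scaled intervals come from a fuzzy number. Level sets determine it,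
  which makes the definite description meaningful.\<close>

lemma lower_upper_fuzzy_scale:
  assumes "k \<ge> 0" "\<alpha> \<in> {0..1}"
  shows "lower (k *\<^sub>F \<mu>) \<alpha> = k * lower \<mu> \<alpha>" "upper (k *\<^sub>F \<mu>) \<alpha> = k * upper \<mu> \<alpha>"
proof -
  have img: "(\<lambda>t. k * t) ` level \<mu> \<beta> = {k * lower \<mu> \<beta>..k * upper \<mu> \<beta>}" if "\<beta> \<in> {0..1}" for \<beta>
    using assms(1) that lower_upper_bounded[of \<beta> \<mu>]
    by (cases "k = 0") (auto simp: level_eq_atLeastAtMost image_mult_atLeastAtMost)
  have "\<exists>\<eta>. \<forall>\<beta>\<in>{0..1}. level \<eta> \<beta> = {k * lower \<mu> \<beta>..k * upper \<mu> \<beta>}"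
    using assms(1) lower_mono_upper_antimono[of _ _ \<mu>] lower_upper_bounded[of 1 \<mu>]
    by (intro fuzzy_number_of_levels tendsto_mult_left lower_upper_tendsto_left
        lower_upper_tendsto_0 mult_left_mono) auto
  then obtain \<eta> where \<eta>: "\<forall>\<beta>\<in>{0..1}. level \<eta> \<beta> = (\<lambda>t. k * t) ` level \<mu> \<beta>"
    using img by auto
  then have "\<forall>\<beta>\<in>{0..1}. level (k *\<^sub>F \<mu>) \<beta> = (\<lambda>t. k * t) ` level \<mu> \<beta>"
    unfolding fuzzy_scale_def by (rule theI) (use \<eta> in \<open>auto intro!: fuzzy_number_eqI\<close>)
  then have "level (k *\<^sub>F \<mu>) \<alpha> = {k * lower \<mu> \<alpha>..k * upper \<mu> \<alpha>}"
    using assms(2) img by simp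
  from lower_upper_eqI[OF this assms(2)]
  show "lower (k *\<^sub>F \<mu>) \<alpha> = k * lower \<mu> \<alpha>" "upper (k *\<^sub>F \<mu>) \<alpha> = k * upper \<mu> \<alpha>" .
qed

text \<open>Dominated convergence for a real parameter, obtained from the sequential version by
  testing along sequences in \<open>T\<close> that avoid \<open>a\<close>.\<close>

lemma integral_tendsto_within:
  fixes \<phi> :: "real \<Rightarrow> 'a::euclidean_space \<Rightarrow> real"
  assumes int: "\<And>\<beta>. \<beta> \<in> T \<Longrightarrow> \<phi> \<beta> integrable_on B" "h integrable_on B"
    and bound: "\<And>\<beta> p. \<beta> \<in> T \<Longrightarrow> p \<in> B \<Longrightarrow> \<bar>\<phi> \<beta> p\<bar> \<le> h p"
    and lim: "\<And>p. p \<in> B \<Longrightarrow> ((\<lambda>\<beta>. \<phi> \<beta> p) \<longlongrightarrow> \<phi> a p) (at a within T)"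
  shows "((\<lambda>\<beta>. integral B (\<phi> \<beta>)) \<longlongrightarrow> integral B (\<phi> a)) (at a within T)"
  unfolding tendsto_at_iff_sequentially
proof (intro allI impI)
  fix X :: "nat \<Rightarrow> real"
  assume X: "\<forall>i. X i \<in> T - {a}" "X \<longlonglongrightarrow> a"
  have "(\<lambda>n. integral B (\<phi> (X n))) \<longlonglongrightarrow> integral B (\<phi> a)"
  proof (rule dominated_convergence(2)[OF _ int(2)])
    fix p assume "p \<in> B"
    from lim[OF this] show "(\<lambda>n. \<phi> (X n) p) \<longlonglongrightarrow> \<phi> a p"
      using X unfolding tendsto_at_iff_sequentially comp_def by blast
  qed (use X int bound in auto)
  then show "((\<lambda>\<beta>. integral B (\<phi> \<beta>)) \<circ> X) \<longlonglongrightarrow> integral B (\<phi> a)"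
    by (simp add: comp_def)
qed

text \<open>Integration preserves the monotonicity of the end points in the level, and dominated
  convergence preserves their one-sided limits, so the integrated intervals again belong to a unique
  fuzzy number.\<close>

lemma lower_upper_fuzzy_integral:
  assumes lc: "\<And>\<beta>. \<beta> \<in> {0..1} \<Longrightarrow> continuous_on (cbox (c, a) (d, b)) (\<lambda>(y, x). lower (g x y) \<beta>)"
    and uc: "\<And>\<beta>. \<beta> \<in> {0..1} \<Longrightarrow> continuous_on (cbox (c, a) (d, b)) (\<lambda>(y, x). upper (g x y) \<beta>)"
    and \<alpha>: "\<alpha> \<in> {0..1}"
  shows "lower (fuzzy_integral a b c d g) \<alpha> =
           integral (cbox (c, a) (d, b)) (\<lambda>(y, x). lower (g x y) \<alpha>)"
    and "upper (fuzzy_integral a b c d g) \<alpha> =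
           integral (cbox (c, a) (d, b)) (\<lambda>(y, x). upper (g x y) \<alpha>)"
proof -
  define B where "B = cbox (c, a) (d, b)"
  define l where "l \<beta> = (\<lambda>(y, x). lower (g x y) \<beta>)" for \<beta>
  define u where "u \<beta> = (\<lambda>(y, x). upper (g x y) \<beta>)" for \<beta>
  \<comment> \<open>All level sets lie inside the one at level 0, so this single function dominates
    the end points at every level.\<close>
  define h where "h p = \<bar>l 0 p\<bar> + \<bar>u 0 p\<bar>" for p
  have cont: "continuous_on B (l \<beta>)" "continuous_on B (u \<beta>)" if "\<beta> \<in> {0..1}" for \<beta>
    using lc[OF that] uc[OF that] by (simp_all add: B_def l_def u_def)
  have int: "l \<beta> integrable_on B" "u \<beta> integrable_on B" if "\<beta> \<in> {0..1}" for \<beta>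
    using cont[OF that] unfolding B_def by (simp_all add: integrable_continuous)
  have "continuous_on B h"
    unfolding h_def using cont[of 0] by (intro continuous_intros) auto
  then have h_int: "h integrable_on B"
    unfolding B_def by (rule integrable_continuous)
  have bound: "\<bar>l \<beta> p\<bar> \<le> h p" "\<bar>u \<beta> p\<bar> \<le> h p" if "\<beta> \<in> {0..1}" for \<beta> p
    using lower_upper_bounded[OF that, of "g (snd p) (fst p)"]
    by (auto simp: h_def l_def u_def case_prod_beta)
  have mono: "l \<beta> p \<le> l \<gamma> p" "u \<gamma> p \<le> u \<beta> p" if "0 \<le> \<beta>" "\<beta> \<le> \<gamma>" "\<gamma> \<le> 1" for \<beta> \<gamma> p
    using lower_mono_upper_antimono[OF that] by (simp_all add: l_def u_def case_prod_beta)
  have lu: "l 1 p \<le> u 1 p" for p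
    using lower_upper_bounded(2)[of 1] by (simp add: l_def u_def case_prod_beta)
  have left: "((\<lambda>\<beta>. l \<beta> p) \<longlongrightarrow> l \<beta> p) (at \<beta> within {0..<\<beta>})"
    "((\<lambda>\<beta>. u \<beta> p) \<longlongrightarrow> u \<beta> p) (at \<beta> within {0..<\<beta>})" if "0 < \<beta>" "\<beta> \<le> 1" for \<beta> p
    using lower_upper_tendsto_left[OF that] by (simp_all add: l_def u_def case_prod_beta)
  have right: "((\<lambda>\<beta>. l \<beta> p) \<longlongrightarrow> l 0 p) (at 0 within {0<..1})"
    "((\<lambda>\<beta>. u \<beta> p) \<longlongrightarrow> u 0 p) (at 0 within {0<..1})" for p
    using lower_upper_tendsto_0 by (simp_all add: l_def u_def case_prod_beta)
  have "\<exists>\<eta>. \<forall>\<beta>\<in>{0..1}. level \<eta> \<beta> = {integral B (l \<beta>)..integral B (u \<beta>)}"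
  proof (rule fuzzy_number_of_levels)
    show "integral B (l \<beta>) \<le> integral B (l \<gamma>)" if "0 \<le> \<beta>" "\<beta> \<le> \<gamma>" "\<gamma> \<le> 1" for \<beta> \<gamma>
      using that mono int by (intro integral_le) auto
    show "integral B (u \<gamma>) \<le> integral B (u \<beta>)" if "0 \<le> \<beta>" "\<beta> \<le> \<gamma>" "\<gamma> \<le> 1" for \<beta> \<gamma>
      using that mono int by (intro integral_le) auto
    show "integral B (l 1) \<le> integral B (u 1)"
      using int lu by (intro integral_le) auto
    show "((\<lambda>\<beta>. integral B (l \<beta>)) \<longlongrightarrow> integral B (l \<beta>)) (at \<beta> within {0..<\<beta>})"
      and "((\<lambda>\<beta>. integral B (u \<beta>)) \<longlongrightarrow> integral B (u \<beta>)) (at \<beta> within {0..<\<beta>})"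
      if "0 < \<beta>" "\<beta> \<le> 1" for \<beta>
      using that by (auto intro!: integral_tendsto_within[OF _ h_int] int bound left)
    show "((\<lambda>\<beta>. integral B (l \<beta>)) \<longlongrightarrow> integral B (l 0)) (at 0 within {0<..1})"
      and "((\<lambda>\<beta>. integral B (u \<beta>)) \<longlongrightarrow> integral B (u 0)) (at 0 within {0<..1})"
      by (auto intro!: integral_tendsto_within[OF _ h_int] int bound right)
  qed
  then obtain \<eta> where \<eta>: "\<forall>\<beta>\<in>{0..1}. level \<eta> \<beta> = {integral B (l \<beta>)..integral B (u \<beta>)}" ..
  \<comment> \<open>Continuity turns the iterated integrals of the definition into integrals over
    the rectangle; \<open>y\<close> comes first in the pairs because its integral is the outer
    one.\<close>
  have fubini: "integral {c..d} (\<lambda>y. integral {a..b} (\<lambda>x. lower (g x y) \<beta>)) = integral B (l \<beta>)"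
    "integral {c..d} (\<lambda>y. integral {a..b} (\<lambda>x. upper (g x y) \<beta>)) = integral B (u \<beta>)"
    if "\<beta> \<in> {0..1}" for \<beta>
    using integral_prod_continuous[of c a d b "l \<beta>"] integral_prod_continuous[of c a d b "u \<beta>"]
      cont[OF that] by (simp_all add: B_def l_def u_def)
  have "fuzzy_integral a b c d g = \<eta>"
    unfolding fuzzy_integral_def
    by (rule the_equality) (use \<eta> in \<open>auto simp: fubini intro!: fuzzy_number_eqI\<close>)
  then have "level (fuzzy_integral a b c d g) \<alpha> = {integral B (l \<alpha>)..integral B (u \<alpha>)}"
    using \<eta> \<alpha> by simp
  from lower_upper_eqI[OF this \<alpha>]
  show "lower (fuzzy_integral a b c d g) \<alpha> = integral (cbox (c, a) (d, b)) (\<lambda>(y, x). lower (g x y) \<alpha>)"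
    and "upper (fuzzy_integral a b c d g) \<alpha> = integral (cbox (c, a) (d, b)) (\<lambda>(y, x). upper (g x y) \<alpha>)"
    by (simp_all add: B_def l_def u_def)
qed

lemma lower_upper_dist_le:
  assumes "\<alpha> \<in> {0..1}"
  shows "\<bar>lower \<mu> \<alpha> - lower \<eta> \<alpha>\<bar> \<le> dist \<mu> \<eta>" "\<bar>upper \<mu> \<alpha> - upper \<eta> \<alpha>\<bar> \<le> dist \<mu> \<eta>"
  using level_dist_le[OF assms, of \<mu> \<eta>] by simp_all

text \<open>At a fixed level each end point is 1-Lipschitz, because \<open>dist\<close> is a
  supremum over all levels.\<close>

lemma continuous_on_lower_upper:
  assumes "\<alpha> \<in> {0..1}" "continuous_on S f"
  shows "continuous_on S (\<lambda>p. lower (f p) \<alpha>)" "continuous_on S (\<lambda>p. upper (f p) \<alpha>)"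
proof -
  have "1-lipschitz_on UNIV (\<lambda>\<mu>. lower \<mu> \<alpha>)" "1-lipschitz_on UNIV (\<lambda>\<mu>. upper \<mu> \<alpha>)"
    using lower_upper_dist_le[OF assms(1)] by (auto intro!: lipschitz_onI simp: dist_real_def)
  then have "continuous_on UNIV (\<lambda>\<mu>. lower \<mu> \<alpha>)" "continuous_on UNIV (\<lambda>\<mu>. upper \<mu> \<alpha>)"
    by (auto intro: lipschitz_on_continuous_on)
  then show "continuous_on S (\<lambda>p. lower (f p) \<alpha>)" "continuous_on S (\<lambda>p. upper (f p) \<alpha>)"
    using assms(2) by (auto intro: continuous_on_compose2)
qed

subsection \<open>The Poisson kernel\<close>

text \<open>The denominator is at least \<open>(1 - r)\<^sup>2\<close>, its value at
  \<open>cos x = 1\<close>.\<close>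

lemma poisson_denominator_pos:
  fixes r x :: real
  assumes "0 \<le> r" "r < 1"
  shows "0 < 1 - 2 * r * cos x + r\<^sup>2"
proof -
  have "r * cos x \<le> r" using assms mult_left_mono[of "cos x" 1 r] by simp
  moreover have "0 < (1 - r)\<^sup>2" using assms by simp
  ultimately show ?thesis by (simp add: power2_eq_square algebra_simps)
qed

lemma poisson_kernel_nonneg:
  assumes "0 \<le> r" "r < 1"
  shows "0 \<le> poisson_kernel r x"
  using poisson_denominator_pos[OF assms, of x] assms
  by (simp add: poisson_kernel_def power_le_one)

lemma continuous_on_poisson_kernel:
  fixes g :: "'a::t2_space \<Rightarrow> real"
  assumes "0 \<le> r" "r < 1" "continuous_on S g"
  shows "continuous_on S (\<lambda>p. poisson_kernel r (g p))"
  unfolding poisson_kernel_def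
  using poisson_denominator_pos[OF assms(1,2)]
  by (intro continuous_intros continuous_on_cos[OF assms(3)]) (auto simp: less_imp_neq[symmetric])

lemma has_integral_poisson_kernel:
  assumes "0 \<le> r" "r < 1"
  shows "(poisson_kernel r has_integral 2 * pi) {-pi..pi}"
proof -
  \<comment> \<open>The arctangent is the imaginary part of \<open>- log (1 - r e\<^sup>i\<^sup>x)\<close>; unlike the half-angle
    antiderivative, it has no singularity at \<open>\<plusminus>\<pi>\<close>.\<close>
  define F where "F x = x + 2 * arctan (r * sin x / (1 - r * cos x))" for x
  have deriv: "(F has_real_derivative poisson_kernel r x) (at x)" for x
  proof -
    define D where "D = 1 - 2 * r * cos x + r\<^sup>2"
    have D: "D > 0" using poisson_denominator_pos[OF assms] by (simp add: D_def)
    \<comment> \<open>The real part of \<open>1 - r e\<^sup>i\<^sup>x\<close>. It is positive, so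
      the quotient under the arctangent is smooth on the whole line.\<close>
    define e where "e = 1 - r * cos x"
    have "r * cos x \<le> r" using assms mult_left_mono[of "cos x" 1 r] by simp
    then have e: "e > 0" using assms by (simp add: e_def)
    have sc: "(sin x)\<^sup>2 = 1 - (cos x)\<^sup>2" by (simp add: sin_squared_eq)
    have "1 + (r * sin x / e)\<^sup>2 = (e\<^sup>2 + r\<^sup>2 * (sin x)\<^sup>2) / e\<^sup>2"
      using e by (simp add: power_divide power_mult_distrib add_divide_distrib)
    \<comment> \<open>Both sides are the squared modulus of
      \<open>1 - r e\<^sup>i\<^sup>x\<close>.\<close>
    also have "e\<^sup>2 + r\<^sup>2 * (sin x)\<^sup>2 = D"
      unfolding sc D_def e_def by (simp add: power2_eq_square algebra_simps)
    finally have inv: "inverse (1 + (r * sin x / e)\<^sup>2) = e\<^sup>2 / D" by simp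
    have quot: "((\<lambda>x. r * sin x / (1 - r * cos x)) has_real_derivative
        (r * cos x * e - r * sin x * (r * sin x)) / e\<^sup>2) (at x)"
      using e unfolding e_def
      by (auto intro!: derivative_eq_intros simp: power2_eq_square algebra_simps)
    have "(F has_real_derivative
        1 + 2 * (inverse (1 + (r * sin x / e)\<^sup>2) *
          ((r * cos x * e - r * sin x * (r * sin x)) / e\<^sup>2))) (at x)"
      unfolding F_def e_def
      by (intro DERIV_add DERIV_ident DERIV_cmult DERIV_chain2[OF DERIV_arctan] quot[unfolded e_def])
    also have "inverse (1 + (r * sin x / e)\<^sup>2) *
          ((r * cos x * e - r * sin x * (r * sin x)) / e\<^sup>2) = (r * cos x * e - r\<^sup>2 * (sin x)\<^sup>2) / D"
      unfolding inv using e D by (simp add: power2_eq_square)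
    also have "r * cos x * e - r\<^sup>2 * (sin x)\<^sup>2 = r * cos x - r\<^sup>2"
      unfolding sc e_def by (simp add: power2_eq_square algebra_simps)
    \<comment> \<open>Over the common denominator the numerator is
      \<open>D + 2 * (r * cos x - r\<^sup>2) = 1 - r\<^sup>2\<close>.\<close>
    also have "1 + 2 * ((r * cos x - r\<^sup>2) / D) = poisson_kernel r x"
      using D unfolding poisson_kernel_def D_def[symmetric]
      by (simp add: field_simps) (simp add: D_def)
    finally show ?thesis .
  qed
  have "(poisson_kernel r has_integral (F pi - F (-pi))) {-pi..pi}"
    using deriv
    by (intro fundamental_theorem_of_calculus)
      (auto intro: has_field_derivative_at_within simp flip: has_real_derivative_iff_has_vector_derivative)
  \<comment> \<open>The sine vanishes at both end points, so only the linear term of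
    \<open>F\<close> contributes.\<close>
  then show ?thesis by (simp add: F_def)
qed

text \<open>The denominator equals \<open>(1 - r)\<^sup>2 + 2 * r * (1 - cos x)\<close>. Multiplying
  by the kernel and dividing by \<open>2 * r\<close>, which is where \<open>r > 0\<close> enters,
  expresses the kernel times \<open>1 - cos x\<close> through the kernel and a constant, both with
  known integrals.\<close>

lemma integral_poisson_kernel:
  assumes "0 < r" "r < 1"
  shows "integral {-pi..pi} (poisson_kernel r) = 2 * pi"
    and "integral {-pi..pi} (\<lambda>x. poisson_kernel r x * (1 - cos x)) = 2 * pi * (1 - r)"
proof -
  note P = has_integral_poisson_kernel[of r]
  show "integral {-pi..pi} (poisson_kernel r) = 2 * pi"
    using P assms by (intro integral_unique) auto
  have eq: "((1 - r\<^sup>2) - (1 - r)\<^sup>2 * poisson_kernel r x) / (2 * r) = poisson_kernel r x * (1 - cos x)" for x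
  proof -
    have D: "1 - 2 * r * cos x + r\<^sup>2 \<noteq> 0"
      using poisson_denominator_pos[of r x] assms by simp
    have "poisson_kernel r x * (1 - 2 * r * cos x + r\<^sup>2) = 1 - r\<^sup>2"
      using D by (simp add: poisson_kernel_def)
    then have "1 - r\<^sup>2 - (1 - r)\<^sup>2 * poisson_kernel r x = poisson_kernel r x * (1 - cos x) * (2 * r)"
      by (simp add: power2_eq_square algebra_simps)
    then show ?thesis using assms by simp
  qed
  have "((\<lambda>x. ((1 - r\<^sup>2) - (1 - r)\<^sup>2 * poisson_kernel r x) / (2 * r)) has_integral
      ((1 - r\<^sup>2) * (2 * pi) - (1 - r)\<^sup>2 * (2 * pi)) / (2 * r)) {-pi..pi}"
    using has_integral_const_real[of "1 - r\<^sup>2" "-pi" pi] P assms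
    by (intro has_integral_divide has_integral_diff has_integral_mult_right) (auto simp: mult_ac)
  \<comment> \<open>Here \<open>(1 - r\<^sup>2) - (1 - r)\<^sup>2 = 2 * r * (1 - r)\<close>.\<close>
  moreover have "((1 - r\<^sup>2) * (2 * pi) - (1 - r)\<^sup>2 * (2 * pi)) / (2 * r) = 2 * pi * (1 - r)"
    using assms by (simp add: field_simps power2_eq_square)
  ultimately show "integral {-pi..pi} (\<lambda>x. poisson_kernel r x * (1 - cos x)) = 2 * pi * (1 - r)"
    unfolding eq by (simp add: integral_unique)
qed

section \<open>The normalised product kernel on the square\<close>

lemma integral_cbox_prod:
  fixes h k :: "real \<Rightarrow> real"
  assumes "continuous_on {c..d} h" "continuous_on {a..b} k"
  shows "integral (cbox (c, a) (d, b)) (\<lambda>(y, x). h y * k x) = integral {c..d} h * integral {a..b} k"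
proof -
  have "continuous_on (cbox (c, a) (d, b)) (\<lambda>(y, x). h y * k x)"
    unfolding case_prod_beta
    by (intro continuous_intros continuous_on_compose2[OF assms(1)] continuous_on_compose2[OF assms(2)])
      (auto simp: cbox_Pair_eq)
  from integral_prod_continuous[OF this] show ?thesis by simp
qed

text \<open>The pairs are ordered \<open>(y, x)\<close>, outer integration variable first, and the
  constant in front of the operator is absorbed so that the total mass becomes 1.\<close>

definition poisson_weight :: "real \<Rightarrow> real \<Rightarrow> real \<times> real \<Rightarrow> real" where
  "poisson_weight r s = (\<lambda>(y, x). poisson_kernel r x * poisson_kernel s y / (4 * pi\<^sup>2))"

lemma poisson_weight_nonneg:
  assumes "0 \<le> r" "r < 1" "0 \<le> s" "s < 1"
  shows "0 \<le> poisson_weight r s p"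
  using assms by (simp add: poisson_weight_def case_prod_beta poisson_kernel_nonneg)

lemma continuous_on_poisson_weight:
  assumes "0 \<le> r" "r < 1" "0 \<le> s" "s < 1"
  shows "continuous_on S (poisson_weight r s)"
  using assms unfolding poisson_weight_def case_prod_beta
  by (intro continuous_intros continuous_on_poisson_kernel) auto

lemma integral_poisson_weight:
  assumes "0 < r" "r < 1" "0 < s" "s < 1"
  shows "integral (cbox (-pi, -pi) (pi, pi)) (poisson_weight r s) = 1"
    and "integral (cbox (-pi, -pi) (pi, pi))
           (\<lambda>p. poisson_weight r s p * ((1 - cos (snd p)) + (1 - cos (fst p)))) = (1 - r) + (1 - s)"
proof -
  have cont: "continuous_on {-pi..pi} (\<lambda>x. poisson_kernel t x * (1 - cos x))"
    "continuous_on {-pi..pi} (poisson_kernel t)" if "0 < t" "t < 1" for t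
    using that continuous_on_poisson_kernel[of t _ "\<lambda>x. x"]
    by (auto intro!: continuous_intros)
  note I = integral_poisson_kernel[OF assms(1,2)] integral_poisson_kernel[OF assms(3,4)]
  define J where "J h k = integral (cbox (-pi, -pi) (pi, pi)) (\<lambda>(y, x). h y * k x)"
    for h k :: "real \<Rightarrow> real"
  have "integral (cbox (-pi, -pi) (pi, pi)) (poisson_weight r s) =
      J (poisson_kernel s) (poisson_kernel r) / (4 * pi\<^sup>2)"
    unfolding J_def integral_divide[symmetric]
    by (intro integral_cong) (simp add: poisson_weight_def case_prod_beta mult_ac)
  then show "integral (cbox (-pi, -pi) (pi, pi)) (poisson_weight r s) = 1"
    using assms by (simp add: J_def integral_cbox_prod cont I power2_eq_square)
  \<comment> \<open>The integrand is split into two summands, each a function of \<open>y\<close>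
    times a function of \<open>x\<close>, so that each integral factors into a one-dimensional mass
    and a one-dimensional moment.\<close>
  have "integral (cbox (-pi, -pi) (pi, pi))
      (\<lambda>p. poisson_weight r s p * ((1 - cos (snd p)) + (1 - cos (fst p)))) =
      integral (cbox (-pi, -pi) (pi, pi))
        (\<lambda>p. (case p of (y, x) \<Rightarrow> poisson_kernel s y * (poisson_kernel r x * (1 - cos x))) / (4 * pi\<^sup>2) +
          (case p of (y, x) \<Rightarrow> poisson_kernel s y * (1 - cos y) * poisson_kernel r x) / (4 * pi\<^sup>2))"
    by (intro integral_cong)
      (simp add: poisson_weight_def case_prod_beta flip: add_divide_distrib, simp add: algebra_simps)
  also have "\<dots> = J (poisson_kernel s) (\<lambda>x. poisson_kernel r x * (1 - cos x)) / (4 * pi\<^sup>2) +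
      J (\<lambda>y. poisson_kernel s y * (1 - cos y)) (poisson_kernel r) / (4 * pi\<^sup>2)"
    unfolding J_def integral_divide[symmetric]
    using assms unfolding case_prod_beta
    by (intro integral_add integrable_continuous continuous_intros continuous_on_poisson_kernel) auto
  also have "\<dots> = (1 - r) + (1 - s)"
    using assms by (simp add: J_def integral_cbox_prod cont I power2_eq_square)
  finally show "integral (cbox (-pi, -pi) (pi, pi))
    (\<lambda>p. poisson_weight r s p * ((1 - cos (snd p)) + (1 - cos (fst p)))) = (1 - r) + (1 - s)" .
qed

text \<open>The kernels are nonnegative, so scaling and integration act on lower and upper end
  points separately. This reduces the fuzzy operator to two real averages at each level.\<close>

lemma lower_upper_abel_poisson:
  assumes f: "continuous_on UNIV f" and rs: "0 \<le> r" "r < 1" "0 \<le> s" "s < 1" and \<alpha>: "\<alpha> \<in> {0..1}"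
  shows "lower (abel_poisson r s f (u, v)) \<alpha> = integral (cbox (-pi, -pi) (pi, pi))
           (\<lambda>p. poisson_weight r s p * lower (f (u - snd p, v - fst p)) \<alpha>)"
    and "upper (abel_poisson r s f (u, v)) \<alpha> = integral (cbox (-pi, -pi) (pi, pi))
           (\<lambda>p. poisson_weight r s p * upper (f (u - snd p, v - fst p)) \<alpha>)"
proof -
  define g where "g x y = (poisson_kernel r x * poisson_kernel s y) *\<^sub>F f (u - x, v - y)" for x y
  have g: "lower (g x y) \<beta> = poisson_kernel r x * poisson_kernel s y * lower (f (u - x, v - y)) \<beta>"
    "upper (g x y) \<beta> = poisson_kernel r x * poisson_kernel s y * upper (f (u - x, v - y)) \<beta>"
    if "\<beta> \<in> {0..1}" for x y \<beta>
    using that rs by (simp_all add: g_def lower_upper_fuzzy_scale poisson_kernel_nonneg)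
  have cont: "continuous_on S (\<lambda>(y, x). lower (g x y) \<beta>)" "continuous_on S (\<lambda>(y, x). upper (g x y) \<beta>)"
    if "\<beta> \<in> {0..1}" for \<beta> S
    using that rs unfolding g[OF that] case_prod_beta
    by (auto intro!: continuous_intros continuous_on_poisson_kernel continuous_on_lower_upper
        continuous_on_compose2[OF f])
  have ap: "abel_poisson r s f (u, v) = (1 / (4 * pi\<^sup>2)) *\<^sub>F fuzzy_integral (-pi) pi (-pi) pi g"
    by (simp add: abel_poisson_def g_def[abs_def])
  show "lower (abel_poisson r s f (u, v)) \<alpha> = integral (cbox (-pi, -pi) (pi, pi))
      (\<lambda>p. poisson_weight r s p * lower (f (u - snd p, v - fst p)) \<alpha>)"
    unfolding ap using \<alpha>
    by (subst lower_upper_fuzzy_scale, simp, simp, subst lower_upper_fuzzy_integral[OF cont(1) cont(2)])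
      (auto simp: g poisson_weight_def case_prod_beta mult_ac simp flip: integral_mult_right
        intro!: integral_cong)
  show "upper (abel_poisson r s f (u, v)) \<alpha> = integral (cbox (-pi, -pi) (pi, pi))
      (\<lambda>p. poisson_weight r s p * upper (f (u - snd p, v - fst p)) \<alpha>)"
    unfolding ap using \<alpha>
    by (subst lower_upper_fuzzy_scale, simp, simp, subst lower_upper_fuzzy_integral[OF cont(1) cont(2)])
      (auto simp: g poisson_weight_def case_prod_beta mult_ac simp flip: integral_mult_right
        intro!: integral_cong)
qed

subsection \<open>Uniform convergence\<close>

text \<open>The weight is nonnegative with mass 1, so the error of the average is at most the
  average of the pointwise bound, and the mean of the cosine term is
  \<open>(1 - r) + (1 - s)\<close>.\<close>

lemma poisson_weight_average_bound:
  assumes h: "continuous_on (cbox (-pi, -pi) (pi, pi)) h"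
    and rs: "0 < r" "r < 1" "0 < s" "s < 1"
    and bound: "\<And>p. p \<in> cbox (-pi, -pi) (pi, pi) \<Longrightarrow>
      \<bar>h p - c\<bar> \<le> e + C * ((1 - cos (snd p)) + (1 - cos (fst p)))"
  shows "\<bar>integral (cbox (-pi, -pi) (pi, pi)) (\<lambda>p. poisson_weight r s p * h p) - c\<bar>
    \<le> e + C * ((1 - r) + (1 - s))"
proof -
  define B :: "(real \<times> real) set" where "B = cbox (-pi, -pi) (pi, pi)"
  define w where "w = poisson_weight r s"
  define q :: "real \<times> real \<Rightarrow> real" where "q p = (1 - cos (snd p)) + (1 - cos (fst p))" for p
  have w_cont: "continuous_on B w"
    using rs by (auto simp: w_def intro: continuous_on_poisson_weight)
  have int: "g integrable_on B" if "continuous_on B g" for g :: "real \<times> real \<Rightarrow> real"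
    using that unfolding B_def by (rule integrable_continuous)
  have h_cont: "continuous_on B h" using h by (simp add: B_def)
  have q_cont: "continuous_on B q" unfolding q_def by (intro continuous_intros)
  note conts = continuous_intros w_cont h_cont q_cont
  have w1: "integral B w = 1" and wq: "integral B (\<lambda>p. w p * q p) = (1 - r) + (1 - s)"
    using integral_poisson_weight[OF rs] by (simp_all add: B_def w_def q_def)
  \<comment> \<open>Since the weight has mass 1, the constant \<open>c\<close> is its own
    average.\<close>
  have "integral B (\<lambda>p. w p * h p) - c = integral B (\<lambda>p. w p * h p) - integral B (\<lambda>p. w p * c)"
    by (simp add: w1)
  also have "\<dots> = integral B (\<lambda>p. w p * (h p - c))"
    by (subst integral_diff[symmetric]) (auto intro!: int conts simp: algebra_simps)
  also have "\<bar>\<dots>\<bar> \<le> integral B (\<lambda>p. w p * e + C * (w p * q p))"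
  proof (rule integral_norm_bound_integral[where 'a = real, unfolded real_norm_def])
    fix p assume "p \<in> B"
    then have "\<bar>h p - c\<bar> \<le> e + C * q p" using bound by (simp add: B_def q_def)
    moreover have "0 \<le> w p" using rs by (simp add: w_def poisson_weight_nonneg)
    ultimately have "w p * \<bar>h p - c\<bar> \<le> w p * (e + C * q p)" by (rule mult_left_mono)
    moreover have "\<bar>w p * (h p - c)\<bar> = w p * \<bar>h p - c\<bar>"
      using \<open>0 \<le> w p\<close> by (simp add: abs_mult)
    ultimately show "\<bar>w p * (h p - c)\<bar> \<le> w p * e + C * (w p * q p)"
      by (simp add: distrib_left mult.left_commute)
  qed (intro int conts)+
  also have "\<dots> = e + C * ((1 - r) + (1 - s))"
    by (subst integral_add) (auto intro!: int conts simp: w1 wq)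
  finally show ?thesis by (simp add: B_def w_def)
qed

text \<open>The estimate for the end points has the same right-hand side at every level, so it
  passes to the supremum defining \<open>dist\<close>.\<close>

lemma dist_abel_poisson_le:
  assumes f: "continuous_on UNIV f" and rs: "0 < r" "r < 1" "0 < s" "s < 1"
    and bound: "\<And>x y. x \<in> {-pi..pi} \<Longrightarrow> y \<in> {-pi..pi} \<Longrightarrow>
      dist (f (u - x, v - y)) (f (u, v)) \<le> e + C * ((1 - cos x) + (1 - cos y))"
  shows "dist (abel_poisson r s f (u, v)) (f (u, v)) \<le> e + C * ((1 - r) + (1 - s))"
  unfolding dist_fuzzy_number_def
proof (rule cSUP_least)
  fix \<alpha> :: real assume \<alpha>: "\<alpha> \<in> {0..1}"
  have shift: "continuous_on S (\<lambda>p. f (u - snd p, v - fst p))" for S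
    by (intro continuous_on_compose2[OF f] continuous_intros) auto
  have b: "dist (f (u - snd p, v - fst p)) (f (u, v)) \<le> e + C * ((1 - cos (snd p)) + (1 - cos (fst p)))"
    if "p \<in> cbox (-pi, -pi) (pi, pi)" for p
    using that bound[of "snd p" "fst p"] by (auto simp: cbox_Pair_eq)
  have "\<bar>lower (abel_poisson r s f (u, v)) \<alpha> - lower (f (u, v)) \<alpha>\<bar> \<le> e + C * ((1 - r) + (1 - s))"
    "\<bar>upper (abel_poisson r s f (u, v)) \<alpha> - upper (f (u, v)) \<alpha>\<bar> \<le> e + C * ((1 - r) + (1 - s))"
    unfolding lower_upper_abel_poisson[OF f less_imp_le[OF rs(1)] rs(2) less_imp_le[OF rs(3)] rs(4) \<alpha>]
    by (rule poisson_weight_average_bound[OF _ rs];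
        use continuous_on_lower_upper[OF \<alpha> shift] lower_upper_dist_le[OF \<alpha>] b in
          \<open>blast intro: order_trans\<close>)+
  then show "max \<bar>lower (abel_poisson r s f (u, v)) \<alpha> - lower (f (u, v)) \<alpha>\<bar>
      \<bar>upper (abel_poisson r s f (u, v)) \<alpha> - upper (f (u, v)) \<alpha>\<bar> \<le> e + C * ((1 - r) + (1 - s))"
    by simp
qed simp

lemma ex_shift_2pi: "\<exists>n::int. u + 2 * of_int n * pi \<in> {-pi..pi}"
proof -
  \<comment> \<open>The number of full periods by which \<open>u\<close> exceeds its representative
    in [-pi, pi); the shift is then by \<open>- n\<close>.\<close>
  define n where "n = \<lfloor>(u + pi) / (2 * pi)\<rfloor>"
  have "of_int n \<le> (u + pi) / (2 * pi)" "(u + pi) / (2 * pi) < of_int n + 1"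
    unfolding n_def by linarith+
  then have "of_int n * (2 * pi) \<le> u + pi" "u + pi < (of_int n + 1) * (2 * pi)"
    by (simp_all add: pos_le_divide_eq pos_divide_less_eq)
  then show ?thesis
    by (intro exI[of _ "- n"]) (auto simp: algebra_simps)
qed

text \<open>For small \<open>x\<close> and \<open>y\<close> uniform continuity gives the bound
  \<open>e\<close>. Otherwise one of \<open>1 - cos x\<close>, \<open>1 - cos y\<close> is bounded
  away from 0, and a large \<open>C\<close> makes the cosine term exceed the diameter of the range.
  Periodicity makes \<open>C\<close> independent of \<open>u\<close> and \<open>v\<close>.\<close>

lemma C_2pi_dist_le_cos:
  assumes f: "f \<in> C_2pi" and e: "e > 0"
  obtains C where "C \<ge> 0"
    "\<And>u v x y. x \<in> {-pi..pi} \<Longrightarrow> y \<in> {-pi..pi} \<Longrightarrow>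
      dist (f (u - x, v - y)) (f (u, v)) \<le> e + C * ((1 - cos x) + (1 - cos y))"
proof -
  \<comment> \<open>The square of half-side \<open>2 * pi\<close> contains a representative in
    [-pi, pi]^2 together with all its translates by \<open>x\<close> and \<open>y\<close> from
    [-pi, pi].\<close>
  define K :: "(real \<times> real) set" where "K = cbox (-2 * pi, -2 * pi) (2 * pi, 2 * pi)"
  have per: "periodic_2pi f" and cont: "continuous_on K f"
    using f by (auto simp: C_2pi_def intro: continuous_on_subset)
  have "compact K" by (simp add: K_def)
  have "bounded (f ` K)"
    using compact_continuous_image[OF cont \<open>compact K\<close>] by (rule compact_imp_bounded)
  then obtain M where M: "\<And>p q. p \<in> K \<Longrightarrow> q \<in> K \<Longrightarrow> dist (f p) (f q) \<le> M"
    unfolding bounded_two_points by blast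
  have "0 \<in> K" by (simp add: K_def zero_prod_def cbox_Pair_eq)
  then have M0: "0 \<le> M" using M[of 0 0] by simp
  obtain d0 where d0: "d0 > 0" "\<And>p q. p \<in> K \<Longrightarrow> q \<in> K \<Longrightarrow> dist p q < d0 \<Longrightarrow> dist (f p) (f q) < e"
    using compact_uniformly_continuous[OF cont \<open>compact K\<close>] e
    unfolding uniformly_continuous_on_def by metis
  \<comment> \<open>Halving is needed because the distance in the plane is bounded by
    \<open>\<bar>x\<bar> + \<bar>y\<bar> < 2 * d\<close>; the cap at pi keeps \<open>d\<close> where
    the cosine is decreasing.\<close>
  define d where "d = min (d0 / 2) pi"
  have d: "0 < d" "d \<le> pi" "2 * d \<le> d0" using d0 by (auto simp: d_def)
  have cd: "cos d < 1" using cos_monotone_0_pi[of 0 d] d by simp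
  \<comment> \<open>Chosen so that \<open>C * (1 - cos d) = M\<close>, the bound on all distances
    between values of \<open>f\<close> on \<open>K\<close>.\<close>
  define C where "C = M / (1 - cos d)"
  have C: "C \<ge> 0" using M0 cd by (simp add: C_def)
  have far: "M \<le> C * (1 - cos x)" if "x \<in> {-pi..pi}" "d \<le> \<bar>x\<bar>" for x
  proof -
    have "cos \<bar>x\<bar> \<le> cos d" using that d by (intro cos_monotone_0_pi_le) auto
    then have "C * (1 - cos d) \<le> C * (1 - cos x)" using C by (intro mult_left_mono) auto
    then show ?thesis using cd by (simp add: C_def)
  qed
  have "dist (f (u - x, v - y)) (f (u, v)) \<le> e + C * ((1 - cos x) + (1 - cos y))"
    if xy: "x \<in> {-pi..pi}" "y \<in> {-pi..pi}" for u v x y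
  proof -
    obtain m n :: int where mn: "u + 2 * of_int m * pi \<in> {-pi..pi}" "v + 2 * of_int n * pi \<in> {-pi..pi}"
      using ex_shift_2pi by blast
    define a b where "a = u + 2 * of_int m * pi" and "b = v + 2 * of_int n * pi"
    have shift: "f (s, t) = f (s + 2 * of_int m * pi, t + 2 * of_int n * pi)" for s t
      using per unfolding periodic_2pi_def by metis
    have eq: "f (u - x, v - y) = f (a - x, b - y)" "f (u, v) = f (a, b)"
      using shift[of "u - x" "v - y"] shift[of u v] by (simp_all add: a_def b_def algebra_simps)
    have inK: "(a - x, b - y) \<in> K" "(a, b) \<in> K"
      using mn xy by (auto simp: K_def a_def b_def cbox_Pair_eq)
    have nonneg: "0 \<le> C * (1 - cos x)" "0 \<le> C * (1 - cos y)" using C by simp_all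
    show ?thesis
    proof (cases "\<bar>x\<bar> < d \<and> \<bar>y\<bar> < d")
      case True
      have "dist (a - x, b - y) (a, b) \<le> \<bar>x\<bar> + \<bar>y\<bar>"
        using sqrt_sum_squares_le_sum_abs[of x y] by (simp add: dist_Pair_Pair dist_real_def)
      then have "dist (f (a - x, b - y)) (f (a, b)) < e"
        using True d by (intro d0(2) inK) linarith
      then show ?thesis using nonneg unfolding eq distrib_left by linarith
    next
      case False
      then have "M \<le> C * (1 - cos x) + C * (1 - cos y)"
        using far[of x] far[of y] xy nonneg by (auto simp: not_less)
      then show ?thesis
        using M[OF inK] e unfolding eq distrib_left by linarith
    qed
  qed
  with C that show ?thesis by blast
qed

theorem mainTheorem6:
  fixes f :: "real \<times> real \<Rightarrow> fuzzy_number"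
  assumes "f \<in> C_2pi"
  shows "uniform_limit UNIV (\<lambda>(r, s). abel_poisson r s f) f
           (at (1, 1) within {0..<1} \<times> {0..<1}) \<and>
         ((\<lambda>(r, s). dist_star (abel_poisson r s f) f) \<longlongrightarrow> 0)
           (at (1, 1) within {0..<1} \<times> {0..<1})"
proof -
  let ?F = "at (1, 1) within {0..<1} \<times> {0..<1} :: (real \<times> real) filter"
  have f: "continuous_on UNIV f" using assms by (simp add: C_2pi_def)
  \<comment> \<open>A bound uniform in the point, from which both conclusions follow; it is applied
    with \<open>e / 2\<close>, since the supremum only inherits the non-strict inequality.\<close>
  have key: "\<forall>\<^sub>F q in ?F. \<forall>p. dist (abel_poisson (fst q) (snd q) f p) (f p) \<le> e" if e: "e > 0" for e
  proof -
    obtain C where C: "C \<ge> 0" "\<And>u v x y. x \<in> {-pi..pi} \<Longrightarrow> y \<in> {-pi..pi} \<Longrightarrow>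
        dist (f (u - x, v - y)) (f (u, v)) \<le> e / 2 + C * ((1 - cos x) + (1 - cos y))"
      using C_2pi_dist_le_cos[OF assms, of "e / 2"] e by auto
    have id: "((\<lambda>q. q) \<longlongrightarrow> (1, 1)) ?F" by (rule tendsto_ident_at)
    have lims: "(fst \<longlongrightarrow> 1) ?F" "(snd \<longlongrightarrow> 1) ?F"
      using tendsto_fst[OF id] tendsto_snd[OF id] by simp_all
    have "((\<lambda>q. e / 2 + C * ((1 - fst q) + (1 - snd q))) \<longlongrightarrow> e / 2 + C * ((1 - 1) + (1 - 1))) ?F"
      by (intro tendsto_intros lims)
    then have small: "\<forall>\<^sub>F q in ?F. e / 2 + C * ((1 - fst q) + (1 - snd q)) < e"
      by (rule order_tendstoD(2)) (use e in simp)
    \<comment> \<open>The approach region includes \<open>r = 0\<close> and \<open>s = 0\<close>,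
      while the moment formula divides by the radius; near (1, 1) both radii are positive.\<close>
    have pos: "\<forall>\<^sub>F q in ?F. 0 < fst q" "\<forall>\<^sub>F q in ?F. 0 < snd q"
      using order_tendstoD(1)[OF lims(1)] order_tendstoD(1)[OF lims(2)] by auto
    have dom: "\<forall>\<^sub>F q in ?F. q \<in> {0..<1} \<times> {0..<1}"
      by (simp add: eventually_at_filter)
    from small pos dom show ?thesis
    proof eventually_elim
      case (elim q)
      have "dist (abel_poisson (fst q) (snd q) f (u, v)) (f (u, v))
          \<le> e / 2 + C * ((1 - fst q) + (1 - snd q))" for u v
        using elim by (intro dist_abel_poisson_le[OF f] C(2)) auto
      from order_trans[OF this less_imp_le[OF elim(1)]] show ?case
        by (simp add: split_paired_all)
    qed
  qed
  have "uniform_limit UNIV (\<lambda>(r, s). abel_poisson r s f) f ?F"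
  proof (rule uniform_limitI)
    fix e :: real assume "e > 0"
    then have "e / 2 > 0" by simp
    from key[OF this]
    show "\<forall>\<^sub>F q in ?F. \<forall>p\<in>UNIV. dist ((case q of (r, s) \<Rightarrow> abel_poisson r s f) p) (f p) < e"
    proof eventually_elim
      case (elim q)
      have "dist (abel_poisson (fst q) (snd q) f p) (f p) < e" for p
        using elim[rule_format, of p] \<open>e > 0\<close> by linarith
      then show ?case by (simp add: case_prod_beta)
    qed
  qed
  moreover have "((\<lambda>(r, s). dist_star (abel_poisson r s f) f) \<longlongrightarrow> 0) ?F"
  proof (rule tendstoI)
    fix e :: real assume "e > 0"
    then have "e / 2 > 0" by simp
    from key[OF this]
    show "\<forall>\<^sub>F q in ?F. dist (case q of (r, s) \<Rightarrow> dist_star (abel_poisson r s f) f) 0 < e"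
    proof eventually_elim
      case (elim q)
      define g where "g p = dist (abel_poisson (fst q) (snd q) f p) (f p)" for p
      have g: "g p \<le> e / 2" for p using elim by (simp only: g_def)
      \<comment> \<open>Boundedness makes the supremum an upper bound for \<open>g\<close>, so it is
        at least \<open>g 0 \<ge> 0\<close> and its absolute value can be estimated.\<close>
      then have "bdd_above (range g)" by (rule bdd_aboveI2)
      then have "g 0 \<le> (SUP p. g p)" by (rule cSUP_upper[OF UNIV_I])
      moreover have "0 \<le> g 0" by (simp add: g_def)
      moreover have "(SUP p. g p) \<le> e / 2"
        using g by (intro cSUP_least) auto
      ultimately have "\<bar>SUP p. g p\<bar> < e" using \<open>e > 0\<close> by linarith
      then show ?case by (simp add: case_prod_beta dist_star_def g_def)
    qed
  qed
  ultimately show ?thesis ..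
qed

end
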